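(* Let $G$ be an abelian group of order $n$, and let $C \subseteq G$ be a non-empty subset of size $k$. If there exists a positive integer $s$ such that $$\frac{s^2 k^3}{n} + \frac{e^s k^{3s}}{n^{s-1}} + k\left(\frac{s^2 k^3}{n}\right)^s < 1,$$ then $C$ is a minimal complement in $G$.
   Context: $C \subseteq G$ is a minimal complement in $G$ if there exists $W \subseteq G$ with $W + C = G$ and $W + C' \neq G$ for every proper subset $C' \subsetneq C$, where $A+B=\{a+b: a\in A, b\in B\}$. *)

theory Defs
  imports Complex_Main "HOL-Library.Set_Algebras" "HOL-Library.Cardinality"
begin

text \<open>
  The group \<open>G\<close> is the whole type, so \<open>G\<close> as a set is \<^term>\<open>UNIV\<close>; \<open>W + C\<close> is the
  Minkowski sum \<open>{w + c | w \<in> W, c \<in> C}\<close> of \<^theory>\<open>HOL-Library.Set_Algebras\<close>.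
\<close>

definition minimal_complement :: "'a::ab_group_add set \<Rightarrow> bool" where
  "minimal_complement C \<longleftrightarrow>
     (\<exists>W. W + C = UNIV \<and> (\<forall>C'. C' \<subset> C \<longrightarrow> W + C' \<noteq> UNIV))"

end

(* Choose g_c for every c in C and let W be the complement of the union of the sets
   g_c - (C - {c}). Then g_c is not in W + (C - {c}), and W + C is everything unless some translate
   g - C is covered by that union. The g_c are chosen greedily so that every g - C meets fewer than
   s of the sets g_c - (C - {c}) and so that no two of them conflict, where a conflict is the pair
   of sets that pigeonhole produces from a cover by at most s - 1 sets: one covering at least
   1/(s - 1) of some g - C, the other at least 1/(s - 2) of the rest. Whether two sets conflict
   depends only on the difference of their positions, and at most s^2 k^2 differences are in
   conflict, so each step has at least n - s^2 k^3 admissible choices. *)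
theory Submission
  imports Defs
begin

section \<open>Translates and double counting\<close>

definition translate :: "'a::ab_group_add \<Rightarrow> 'a set \<Rightarrow> 'a set" where
  "translate h X = (+) h ` X"

lemma mem_translate: "x \<in> translate h X \<longleftrightarrow> x - h \<in> X"
  unfolding translate_def by (auto simp: image_iff intro!: bexI[of _ "x - h"])

lemma card_translate [simp]: "card (translate h X) = card X"
  unfolding translate_def by (simp add: card_image)

lemma translate_translate: "translate a (translate b X) = translate (a + b) X"
  by (auto simp: mem_translate algebra_simps)

lemma translate_0 [simp]: "translate 0 X = X"
  by (auto simp: mem_translate)

lemma translate_Int: "translate h (X \<inter> Y) = translate h X \<inter> translate h Y"
  by (auto simp: mem_translate)

lemma translate_Diff: "translate h (X - Y) = translate h X - translate h Y"
  by (auto simp: mem_translate)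

lemma translate_mono: "X \<subseteq> Y \<Longrightarrow> translate h X \<subseteq> translate h Y"
  by (auto simp: mem_translate)

text \<open>A pair of \<open>x\<close> in \<open>X\<close> and \<open>y\<close> in \<open>Y\<close>
  is counted for exactly one shift, namely \<open>d = y - x\<close>.\<close>

lemma sum_card_translate_Int:
  fixes X Y :: "'a::{ab_group_add, finite} set"
  shows "(\<Sum>d\<in>UNIV. card (translate d X \<inter> Y)) = card X * card Y"
proof -
  have "(\<Sum>d\<in>UNIV. card (translate d X \<inter> Y)) = card (SIGMA d:UNIV. translate d X \<inter> Y)"
    by simp
  also have "\<dots> = card (X \<times> Y)"
    by (rule bij_betw_same_card[of "\<lambda>(d, y). (y - d, y)"],
        rule bij_betw_byWitness[where f' = "\<lambda>(x, y). (y - x, y)"])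
       (auto simp: mem_translate)
  finally show ?thesis by (simp add: card_cartesian_product)
qed

text \<open>Markov's inequality without division. Together with
  \<open>sum_card_translate_Int\<close> it yields the counts of shifts below.\<close>

lemma card_mult_le_sum:
  fixes f :: "'b \<Rightarrow> nat"
  assumes "finite U" "S \<subseteq> U" "\<And>x. x \<in> S \<Longrightarrow> b \<le> f x"
  shows "card S * b \<le> sum f U"
proof -
  have "card S * b \<le> sum f S" using sum_bounded_below[of S b f] assms(3) by simp
  also have "\<dots> \<le> sum f U" using assms by (intro sum_mono2) auto
  finally show ?thesis .
qed

lemma card_meeting_translates:
  fixes X Y :: "'a::{ab_group_add, finite} set"
  shows "card {h. translate h X \<inter> Y \<noteq> {}} \<le> card X * card Y"
proof -
  have "card {h. translate h X \<inter> Y \<noteq> {}} * 1 \<le> (\<Sum>d\<in>UNIV. card (translate d X \<inter> Y))"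
    by (rule card_mult_le_sum) (auto simp: Suc_le_eq card_gt_0_iff)
  then show ?thesis by (simp add: sum_card_translate_Int)
qed

section \<open>Conflicts forced by a cover\<close>

text \<open>A translate of \<open>D\<close> of which \<open>X\<close> contains a fraction at least \<open>1 / t\<close>, while \<open>Y\<close> contains
  a fraction at least \<open>1 / (t - 1)\<close> of what \<open>X\<close> leaves uncovered: by pigeonhole, this occurs in any
  covering of a translate of \<open>D\<close> by at most \<open>t\<close> sets.\<close>

definition conflict :: "nat \<Rightarrow> 'a::ab_group_add set \<Rightarrow> 'a set \<Rightarrow> 'a set \<Rightarrow> bool" where
  "conflict t D X Y \<longleftrightarrow> (\<exists>g. card D \<le> t * card (translate g D \<inter> X) \<and>
     card (translate g D - X) \<le> (t - 1) * card ((translate g D - X) \<inter> Y))"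

text \<open>Shifting the witness \<open>g\<close> along with both sets preserves every cardinality
  involved; the converse is the same implication for \<open>- a\<close>. Hence only the difference
  of two positions matters.\<close>

lemma conflict_translate:
  fixes D X Y :: "'a::ab_group_add set"
  shows "conflict t D (translate a X) (translate a Y) \<longleftrightarrow> conflict t D X Y"
proof -
  have *: "conflict t D (translate a X) (translate a Y)" if conf: "conflict t D X Y" for a X Y
  proof -
    obtain g where g: "card D \<le> t * card (translate g D \<inter> X)"
      "card (translate g D - X) \<le> (t - 1) * card ((translate g D - X) \<inter> Y)"
      using conf unfolding conflict_def by blast
    have "card (translate (a + g) D \<inter> translate a X) = card (translate g D \<inter> X)"
      "card (translate (a + g) D - translate a X) = card (translate g D - X)"
      "card ((translate (a + g) D - translate a X) \<inter> translate a Y)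
         = card ((translate g D - X) \<inter> Y)"
      by (simp_all flip: translate_translate translate_Int translate_Diff)
    with g show ?thesis unfolding conflict_def by metis
  qed
  from *[of X Y a] *[of "translate a X" "translate a Y" "- a"] show ?thesis
    by (auto simp: translate_translate)
qed

lemma pigeonhole_cover:
  assumes "finite M" "finite R" "R \<noteq> {}" "R \<subseteq> (\<Union>c\<in>M. X c)" "card M \<le> t"
  obtains c where "c \<in> M" "card R \<le> t * card (R \<inter> X c)"
proof -
  have "M \<noteq> {}" using assms by auto
  define m where "m = Max ((\<lambda>c. card (R \<inter> X c)) ` M)"
  have "m \<in> (\<lambda>c. card (R \<inter> X c)) ` M"
    unfolding m_def using assms \<open>M \<noteq> {}\<close> by (intro Max_in) auto
  then obtain c where c: "c \<in> M" "m = card (R \<inter> X c)" by auto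
  have "card R = card (\<Union>c\<in>M. R \<inter> X c)" using assms by (intro arg_cong[of _ _ card]) auto
  also have "\<dots> \<le> (\<Sum>c\<in>M. card (R \<inter> X c))" using assms by (intro card_UN_le) auto
  also have "\<dots> \<le> (\<Sum>c\<in>M. m)" unfolding m_def using assms by (intro sum_mono Max_ge) auto
  also have "\<dots> \<le> t * m" using assms by simp
  finally show ?thesis using c that by blast
qed

text \<open>Pigeonhole is applied twice: to the whole translate, then to what the first set leaves.
  The remainder is nonempty because each set is smaller than \<open>D\<close>, and it is covered by
  the other sets, which makes the indices distinct and lowers \<open>t\<close> to
  \<open>t - 1\<close>.\<close>

lemma cover_imp_conflict:
  fixes D :: "'a::{ab_group_add, finite} set"
  assumes "finite M" "D \<noteq> {}" "translate g D \<subseteq> (\<Union>c\<in>M. X c)" "card M \<le> t"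
    and small: "\<And>c. c \<in> M \<Longrightarrow> card (X c) < card D"
  obtains c c' where "c \<in> M" "c' \<in> M" "c \<noteq> c'" "conflict t D (X c) (X c')"
proof -
  have "translate g D \<noteq> {}" using assms(2) by (simp add: translate_def)
  then obtain c where c: "c \<in> M" "card (translate g D) \<le> t * card (translate g D \<inter> X c)"
    using pigeonhole_cover[OF assms(1) finite _ assms(3,4)] by metis
  have "translate g D - X c \<noteq> {}"
    using small[OF c(1)] card_mono[of "X c" "translate g D"] by auto
  moreover have "card (M - {c}) \<le> t - 1" using c assms by simp
  moreover have "translate g D - X c \<subseteq> (\<Union>c\<in>M - {c}. X c)" using assms(3) by blast
  ultimately obtain c' where c': "c' \<in> M - {c}"
      "card (translate g D - X c) \<le> (t - 1) * card ((translate g D - X c) \<inter> X c')"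
    using pigeonhole_cover[OF finite_Diff[OF assms(1)] finite] by metis
  show ?thesis
    by (rule that[of c c']) (use c c' in \<open>auto simp: conflict_def\<close>)
qed

section \<open>Counting the differences in conflict\<close>

text \<open>If the first set of a conflict covers between \<open>1 / t\<close> and \<open>(t - 1) / t\<close> of a translate of
  \<open>D\<close>, the product of the two overlaps is at least \<open>(card D / t)\<^sup>2\<close>. This condition is symmetric, so
  both orders of the two sets are counted at once; losing a factor of two here would be too much.
  The set \<open>lopsided_differences\<close> below treats the remaining conflicts and is small enough to be
  counted twice.\<close>

definition balanced_differences :: "nat \<Rightarrow> 'a::ab_group_add set \<Rightarrow> 'a set" where
  "balanced_differences t D = (\<lambda>(u, v). u - v) ` {(u, v).
     card D ^ 2 \<le> t ^ 2 * (card (translate u D \<inter> D) * card (translate v D \<inter> D))}"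

lemma uminus_balanced_differences:
  assumes "d \<in> balanced_differences t D" shows "- d \<in> balanced_differences t D"
proof -
  from assms obtain u v where "d = u - v"
    "card D ^ 2 \<le> t ^ 2 * (card (translate u D \<inter> D) * card (translate v D \<inter> D))"
    by (auto simp: balanced_differences_def)
  then show ?thesis unfolding balanced_differences_def
    by (intro image_eqI[of _ _ "(v, u)"]) (auto simp: mult.commute)
qed

lemma card_balanced_differences:
  fixes D :: "'a::{ab_group_add, finite} set"
  assumes "D \<noteq> {}"
  shows "card (balanced_differences t D) \<le> t ^ 2 * card D ^ 2"
proof -
  let ?r = "\<lambda>u. card (translate u D \<inter> D)"
  define P where "P = {(u, v). card D ^ 2 \<le> t ^ 2 * (?r u * ?r v)}"
  have "card P * card D ^ 2 \<le> (\<Sum>(u, v)\<in>UNIV. t ^ 2 * (?r u * ?r v))"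
    by (rule card_mult_le_sum) (auto simp: P_def)
  also have "\<dots> = t ^ 2 * ((\<Sum>u\<in>UNIV. ?r u) * (\<Sum>v\<in>UNIV. ?r v))"
    unfolding sum_product sum.cartesian_product UNIV_Times_UNIV
    by (simp add: sum_distrib_left split_beta)
  also have "\<dots> = t ^ 2 * card D ^ 2 * card D ^ 2"
    by (simp add: sum_card_translate_Int power2_eq_square)
  finally have "card P \<le> t ^ 2 * card D ^ 2"
    using assms by (simp add: card_gt_0_iff)
  moreover have "card (balanced_differences t D) \<le> card P"
    unfolding balanced_differences_def P_def by (rule card_image_le) simp
  ultimately show ?thesis by linarith
qed

definition lopsided_differences :: "nat \<Rightarrow> 'a::ab_group_add set \<Rightarrow> 'a set \<Rightarrow> 'a set \<Rightarrow> 'a set" where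
  "lopsided_differences t D A A' = (\<Union>g\<in>{g. card D * (t - 1) \<le> t * card (translate g D \<inter> A)}.
     {d. card (translate g D - A) \<le> (t - 1) * card (translate d A' \<inter> (translate g D - A))})"

text \<open>Two Markov bounds: there are at most \<open>t * card A / (t - 1)\<close> shifts
  \<open>g\<close>, and each allows at most \<open>(t - 1) * card A'\<close> values of
  \<open>d\<close>. The factors \<open>t - 1\<close> cancel in the product.\<close>

lemma card_lopsided_differences:
  fixes D :: "'a::{ab_group_add, finite} set"
  assumes "card A < card D" "card A' < card D"
  shows "card (lopsided_differences t D A A') \<le> t * card D ^ 2"
proof -
  define G where "G = {g. card D * (t - 1) \<le> t * card (translate g D \<inter> A)}"
  have "card G * (card D * (t - 1)) \<le> (\<Sum>g\<in>UNIV. t * card (translate g D \<inter> A))"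
    by (rule card_mult_le_sum) (auto simp: G_def)
  also have "\<dots> = card D * (t * card A)"
    by (simp add: sum_card_translate_Int mult_ac flip: sum_distrib_left)
  finally have "card D * (card G * (t - 1)) \<le> card D * (t * card A)"
    by (simp add: mult_ac)
  then have G: "card G * (t - 1) \<le> t * card A" using assms by simp
  have each: "card {d. card (translate g D - A) \<le> (t - 1) * card (translate d A' \<inter> (translate g D - A))}
      \<le> (t - 1) * card A'" (is "card ?H \<le> _") for g
  proof -
    define R where "R = translate g D - A"
    have "\<not> translate g D \<subseteq> A"
      using assms(1) card_mono[of A "translate g D"] by auto
    then have "card R > 0" by (auto simp: R_def card_gt_0_iff)
    have "card ?H * card R \<le> (\<Sum>d\<in>UNIV. (t - 1) * card (translate d A' \<inter> R))"
      by (rule card_mult_le_sum) (auto simp: R_def)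
    also have "\<dots> = (t - 1) * card A' * card R"
      by (simp add: sum_card_translate_Int mult_ac flip: sum_distrib_left)
    finally show ?thesis using \<open>card R > 0\<close> by simp
  qed
  have "card (lopsided_differences t D A A') \<le> (\<Sum>g\<in>G. (t - 1) * card A')"
    unfolding lopsided_differences_def G_def[symmetric]
    by (rule order_trans[OF card_UN_le sum_mono]) (use each in auto)
  also have "\<dots> = card G * (t - 1) * card A'" by simp
  also have "\<dots> \<le> (t * card A) * card A'" using G by (rule mult_right_mono) simp
  also have "\<dots> \<le> (t * card D) * card D" using assms by (intro mult_mono) auto
  finally show ?thesis by (simp add: power2_eq_square mult_ac)
qed

lemma conflict_translate_cases:
  fixes D :: "'a::{ab_group_add, finite} set"
  assumes "A \<subset> D" "A' \<subseteq> D" "conflict t D A (translate d A')"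
  shows "d \<in> balanced_differences t D \<union> lopsided_differences t D A A'"
proof -
  obtain g where g: "card D \<le> t * card (translate g D \<inter> A)"
     "card (translate g D - A) \<le> (t - 1) * card ((translate g D - A) \<inter> translate d A')"
    using assms(3) unfolding conflict_def by blast
  show ?thesis
  proof (cases "card D * (t - 1) \<le> t * card (translate g D \<inter> A)")
    case True
    with g(2) show ?thesis unfolding lopsided_differences_def by (auto simp: Int_commute)
  next
    case False
    define a b k where "a = card (translate g D \<inter> A)"
      and "b = card ((translate g D - A) \<inter> translate d A')" and "k = card D"
    have rest: "card (translate g D - A) = k - a"
      by (simp add: a_def k_def card_Diff_subset_Int)
    have "card A < card D" using assms(1) by (simp add: psubset_card_mono)
    moreover have "a \<le> card A" by (simp add: a_def card_mono)
    ultimately have "a < k" by (simp add: k_def)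
    \<comment> \<open>For \<open>t = 0\<close> the first overlap bound fails, and for
      \<open>t = 1\<close> the second one fails since the remainder is nonempty. So
      \<open>t - 1\<close> is a positive, genuine subtraction.\<close>
    have "t \<noteq> 0" "t \<noteq> 1" using g rest \<open>a < k\<close> by (auto simp: a_def k_def)
    then have "real t > 1" by linarith
    have 1: "real k \<le> real t * real a"
      using g(1) by (simp add: a_def k_def flip: of_nat_mult)
    have "real (t * a) \<le> real (k * (t - 1))" using False by (simp add: a_def k_def del: of_nat_mult)
    then have 2: "real t * real a \<le> real k * (real t - 1)"
      using \<open>real t > 1\<close> by simp
    have "real (k - a) \<le> real ((t - 1) * b)" using g(2) rest by (simp add: b_def del: of_nat_mult)
    then have 3: "real k - real a \<le> (real t - 1) * real b"
      using \<open>a < k\<close> \<open>real t > 1\<close> by simp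
    \<comment> \<open>As \<open>a\<close> lies between \<open>k / t\<close> and
      \<open>k * (t - 1) / t\<close>, the concave product \<open>a * (k - a)\<close> is at least its
      value at these endpoints; multiplying out the two nonnegative factors says this.\<close>
    have "0 \<le> (real t * real a - real k) * (real k * (real t - 1) - real t * real a)"
      using 1 2 by simp
    then have "real k ^ 2 * (real t - 1) \<le> real t ^ 2 * real a * (real k - real a)"
      by (simp add: algebra_simps power2_eq_square)
    also have "\<dots> \<le> real t ^ 2 * real a * ((real t - 1) * real b)"
      using 3 by (intro mult_left_mono) auto
    also have "\<dots> = (real t ^ 2 * (real a * real b)) * (real t - 1)" by simp
    finally have "real k ^ 2 \<le> real t ^ 2 * (real a * real b)"
      using \<open>real t > 1\<close> by simp
    then have "k ^ 2 \<le> t ^ 2 * (a * b)"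
      by (simp flip: of_nat_mult of_nat_power)
    moreover have "a \<le> card (translate g D \<inter> D)"
      unfolding a_def using assms(1) by (intro card_mono) auto
    moreover have "b \<le> card (translate (g - d) D \<inter> D)"
    proof -
      have "b \<le> card (translate g D \<inter> translate d D)"
        unfolding b_def using translate_mono[OF assms(2), of d] by (intro card_mono) auto
      also have "translate g D \<inter> translate d D = translate d (translate (g - d) D \<inter> D)"
        by (simp add: translate_translate translate_Int)
      finally show ?thesis by simp
    qed
    ultimately have "k ^ 2 \<le> t ^ 2 * (card (translate g D \<inter> D) * card (translate (g - d) D \<inter> D))"
      by (meson mult_le_mono order_trans order_refl)
    then have "d \<in> balanced_differences t D"
      unfolding balanced_differences_def k_def by (intro image_eqI[of _ _ "(g, g - d)"]) auto
    then show ?thesis by simp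
  qed
qed

text \<open>The balanced part is counted once and the lopsided part twice, so
  \<open>t ^ 2 + 2 * t\<close> bounds the coefficient of \<open>card D ^ 2\<close>. For
  \<open>t = s - 1\<close> the stated bound has coefficient \<open>s ^ 2\<close>.\<close>

lemma card_conflicts:
  fixes D :: "'a::{ab_group_add, finite} set"
  assumes "A \<subset> D" "A' \<subset> D"
  shows "card {h. conflict t D (translate e A) (translate h A') \<or>
                  conflict t D (translate h A') (translate e A)} \<le> (t + 1) ^ 2 * card D ^ 2"
    (is "card ?B \<le> _")
proof -
  \<comment> \<open>A conflict in the reversed order restricts \<open>e - h\<close> instead of
    \<open>h - e\<close>, hence the negated third set. The balanced set is closed under negation and
    needs no second copy.\<close>
  let ?E = "balanced_differences t D \<union> lopsided_differences t D A A'
              \<union> uminus ` lopsided_differences t D A' A"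
  have "h - e \<in> ?E" if "h \<in> ?B" for h
  proof -
    have "conflict t D A (translate (h - e) A') \<or> conflict t D A' (translate (- (h - e)) A)"
      using that conflict_translate[of t D "- e" "translate e A" "translate h A'"]
        conflict_translate[of t D "- h" "translate h A'" "translate e A"]
      by (auto simp: translate_translate)
    then show ?thesis
    proof
      assume "conflict t D A (translate (h - e) A')"
      with conflict_translate_cases[of A D A' t "h - e"] assms show ?thesis by simp
    next
      assume "conflict t D A' (translate (- (h - e)) A)"
      with conflict_translate_cases[of A' D A t "- (h - e)"] assms
      have "- (h - e) \<in> balanced_differences t D \<union> lopsided_differences t D A' A" by simp
      moreover have "h - e \<in> balanced_differences t D"
        if "- (h - e) \<in> balanced_differences t D"
        using uminus_balanced_differences[OF that] by simp
      moreover have "h - e \<in> uminus ` lopsided_differences t D A' A"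
        if "- (h - e) \<in> lopsided_differences t D A' A"
        using imageI[OF that, of uminus] by simp
      ultimately show ?thesis by blast
    qed
  qed
  then have "?B \<subseteq> translate e ?E" by (auto simp: mem_translate)
  then have "card ?B \<le> card (translate e ?E)" by (intro card_mono) auto
  also have "\<dots> \<le> card (balanced_differences t D) + card (lopsided_differences t D A A')
      + card (uminus ` lopsided_differences t D A' A)"
    unfolding card_translate by (intro order_trans[OF card_Un_le] add_right_mono card_Un_le)
  also have "\<dots> \<le> t ^ 2 * card D ^ 2 + t * card D ^ 2 + t * card D ^ 2"
  proof (intro add_mono card_balanced_differences card_lopsided_differences)
    show "card (uminus ` lopsided_differences t D A' A) \<le> t * card D ^ 2"
      using card_lopsided_differences[of A' D A t] assms
      by (simp add: card_image psubset_card_mono)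
  qed (use assms in \<open>auto simp: psubset_card_mono\<close>)
  also have "\<dots> \<le> (t + 1) ^ 2 * card D ^ 2"
    by (simp add: power2_eq_square algebra_simps)
  finally show ?thesis .
qed

section \<open>Greedy choice by averaging a potential\<close>

lemma exists_le_average:
  fixes F :: "'b \<Rightarrow> real"
  assumes "finite S" "S \<noteq> {}" "sum F S \<le> real (card S) * B"
  obtains x where "x \<in> S" "F x \<le> B"
proof (rule ccontr)
  assume "\<not> thesis"
  then have "(\<Sum>x\<in>S. B) < sum F S"
    using assms(1,2) by (intro sum_strict_mono) (use that not_le in blast)+
  with assms show False by simp
qed

text \<open>The method of conditional expectations, applied to a Chernoff bound on the number of
  indices whose choice meets \<open>g\<close>.\<close>

lemma greedy_choice:
  fixes bad :: "'i \<Rightarrow> 'a::finite \<Rightarrow> 'i \<Rightarrow> 'a \<Rightarrow> bool" and meets :: "'b::finite \<Rightarrow> 'i \<Rightarrow> 'a \<Rightarrow> bool"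
    and z \<delta> :: real
  assumes "finite I" "z \<ge> 1" "\<delta> > 0"
    and bad: "\<And>i j e. i \<in> I \<Longrightarrow> j \<in> I \<Longrightarrow> card {h. bad i e j h} \<le> b"
    and sym: "\<And>i j e h. bad i e j h \<Longrightarrow> bad j h i e"
    and meets: "\<And>g i. i \<in> I \<Longrightarrow> card {h. meets g i h} \<le> q"
    and room: "real (card I * b) \<le> (1 - \<delta>) * CARD('a)"
  shows "\<exists>f. (\<forall>i\<in>I. \<forall>j\<in>I. i \<noteq> j \<longrightarrow> \<not> bad i (f i) j (f j)) \<and>
     (\<Sum>g\<in>UNIV. z ^ card {i\<in>I. meets g i (f i)})
       \<le> CARD('b) * (1 + (z - 1) * q / (\<delta> * CARD('a))) ^ card I"
  using assms(1) bad meets room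
proof (induction I rule: finite_induct)
  case empty
  then show ?case by simp
next
  case (insert i I)
  let ?n = "real CARD('a)"
  \<comment> \<open>The factor by which one further index may multiply the potential.\<close>
  define \<rho> where "\<rho> = 1 + (z - 1) * q / (\<delta> * ?n)"
  have "real (card I * b) \<le> real (card (insert i I) * b)"
    using insert.hyps by (simp del: of_nat_mult)
  then have room: "real (card I * b) \<le> (1 - \<delta>) * ?n"
    using insert.prems(3) by linarith
  have "\<exists>f. (\<forall>i\<in>I. \<forall>j\<in>I. i \<noteq> j \<longrightarrow> \<not> bad i (f i) j (f j)) \<and>
      (\<Sum>g\<in>UNIV. z ^ card {i\<in>I. meets g i (f i)}) \<le> CARD('b) * \<rho> ^ card I"
    unfolding \<rho>_def using room by (intro insert.IH insert.prems(1,2)) auto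
  then obtain f where
    f: "\<forall>i\<in>I. \<forall>j\<in>I. i \<noteq> j \<longrightarrow> \<not> bad i (f i) j (f j)"
    and pot: "(\<Sum>g\<in>UNIV. z ^ card {i\<in>I. meets g i (f i)}) \<le> CARD('b) * \<rho> ^ card I"
    by blast
  define w where "w g = z ^ card {i\<in>I. meets g i (f i)}" for g
  have w: "w g \<ge> 0" for g using assms(2) by (simp add: w_def)
  \<comment> \<open>The positions for \<open>i\<close> that are not bad with respect to any earlier
    choice; at least \<open>\<delta> * ?n\<close> of them remain.\<close>
  define S where "S = - (\<Union>j\<in>I. {h. bad j (f j) i h})"
  have "card (\<Union>j\<in>I. {h. bad j (f j) i h}) \<le> (\<Sum>j\<in>I. b)"
    by (rule order_trans[OF card_UN_le sum_mono]) (use insert in auto)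
  also have "\<dots> \<le> card (insert i I) * b" using insert.hyps by simp
  finally have "real (card (\<Union>j\<in>I. {h. bad j (f j) i h})) \<le> (1 - \<delta>) * ?n"
    using insert.prems(3) by (meson of_nat_le_iff order_trans)
  moreover have "real (card S) = ?n - real (card (\<Union>j\<in>I. {h. bad j (f j) i h}))"
    unfolding S_def by (simp add: Compl_eq_Diff_UNIV card_Diff_subset card_mono)
  ultimately have S: "\<delta> * ?n \<le> card S" by (simp add: algebra_simps)
  have pos: "\<delta> * ?n > 0" using assms(3) by simp
  have "S \<noteq> {}" using S pos by auto
  have step: "(\<Sum>h\<in>S. if meets g i h then z else 1) \<le> card S * \<rho>" for g
  proof -
    have "(\<Sum>h\<in>S. if meets g i h then z else 1) = (\<Sum>h\<in>S. 1 + (if meets g i h then z - 1 else 0))"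
      by (intro sum.cong) auto
    also have "\<dots> = card S + (z - 1) * card {h\<in>S. meets g i h}"
      by (simp add: sum.distrib sum.If_cases Int_def)
    also have "\<dots> \<le> card S + (z - 1) * q"
    proof -
      have "card {h\<in>S. meets g i h} \<le> card {h. meets g i h}" by (intro card_mono) auto
      also have "\<dots> \<le> q" using insert.prems by simp
      finally show ?thesis using assms(2) by (intro add_left_mono mult_left_mono) auto
    qed
    \<comment> \<open>The inserted quotient is at least 1. It makes the bound proportional to
      \<open>card S\<close>, so that averaging over \<open>S\<close> gives a factor free of
      \<open>card S\<close>.\<close>
    also have "\<dots> \<le> card S + (z - 1) * q * (card S / (\<delta> * ?n))"
    proof -
      have "1 \<le> card S / (\<delta> * ?n)" using S pos by simp
      then have "(z - 1) * q * 1 \<le> (z - 1) * q * (card S / (\<delta> * ?n))"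
        using assms(2) by (intro mult_left_mono) auto
      then show ?thesis by simp
    qed
    also have "\<dots> = card S * \<rho>" by (simp add: \<rho>_def field_simps)
    finally show ?thesis .
  qed
  have "(\<Sum>h\<in>S. \<Sum>g\<in>UNIV. w g * (if meets g i h then z else 1))
      = (\<Sum>g\<in>UNIV. w g * (\<Sum>h\<in>S. if meets g i h then z else 1))"
    by (subst sum.swap) (simp add: sum_distrib_left)
  also have "\<dots> \<le> (\<Sum>g\<in>UNIV. w g * (card S * \<rho>))"
    using step w by (intro sum_mono mult_left_mono)
  also have "\<dots> = card S * ((\<Sum>g\<in>UNIV. w g) * \<rho>)" by (simp add: sum_distrib_left mult_ac flip: sum_distrib_right)
  finally obtain h where h: "h \<in> S"
    "(\<Sum>g\<in>UNIV. w g * (if meets g i h then z else 1)) \<le> (\<Sum>g\<in>UNIV. w g) * \<rho>"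
    using exists_le_average[of S] \<open>S \<noteq> {}\<close> by auto
  define f' where "f' = f(i := h)"
  \<comment> \<open>The new index raises the exponent by one exactly for those \<open>g\<close> that
    it meets.\<close>
  have "z ^ card {j \<in> insert i I. meets g j (f' j)} = w g * (if meets g i h then z else 1)" for g
  proof -
    have "{j \<in> insert i I. meets g j (f' j)} =
      (if meets g i h then insert i {j\<in>I. meets g j (f j)} else {j\<in>I. meets g j (f j)})"
      using insert.hyps by (auto simp: f'_def)
    then show ?thesis using insert.hyps by (simp add: w_def)
  qed
  then have "(\<Sum>g\<in>UNIV. z ^ card {j \<in> insert i I. meets g j (f' j)}) \<le> (\<Sum>g\<in>UNIV. w g) * \<rho>"
    using h by simp
  also have "\<dots> \<le> (CARD('b) * \<rho> ^ card I) * \<rho>"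
    using pot assms(2) pos by (intro mult_right_mono) (auto simp: w_def \<rho>_def)
  finally have "(\<Sum>g\<in>UNIV. z ^ card {j \<in> insert i I. meets g j (f' j)})
      \<le> CARD('b) * \<rho> ^ card (insert i I)"
    using insert.hyps by (simp add: mult_ac)
  moreover have "\<not> bad j (f j) i h" "\<not> bad i h j (f j)" if "j \<in> I" for j
    using h(1) that sym[of i h j "f j"] by (auto simp: S_def)
  then have "\<forall>j\<in>insert i I. \<forall>l\<in>insert i I. j \<noteq> l \<longrightarrow> \<not> bad j (f' j) l (f' l)"
    using f by (simp add: f'_def)
  ultimately show ?case unfolding \<rho>_def by blast
qed


section \<open>An inequality between the parameters\<close>

text \<open>Bernoulli's inequality turns \<open>k x\<^sup>s < 1 - x\<close> into \<open>s (1 - x) > 1 - (1 - x) / 2\<close>.\<close>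

lemma le_power_mult_one_minus:
  fixes x k :: real
  assumes "0 \<le> x" "x < 1" "s \<ge> 2" "k \<ge> 2" "k * x ^ s \<le> 1 - x"
  shows "1 - x \<le> (real s * (1 - x)) ^ s"
proof (cases "real s * (1 - x) \<ge> 1")
  case True
  then have "1 \<le> (real s * (1 - x)) ^ s" by (rule one_le_power)
  then show ?thesis using assms(1) by linarith
next
  case False
  define d where "d = 1 - x"
  have d: "0 < d" "d \<le> 1" using assms by (auto simp: d_def)
  have "2 * d \<le> real s * d" using assms(3) d by (intro mult_right_mono) auto
  have sd: "real s * d < 1" using False by (simp add: d_def)
  have "1 - real s * d \<le> (1 - d) ^ s"
    using Bernoulli_inequality[of "- d" s] d by simp
  also have "\<dots> \<le> d / 2"
  proof -
    have "2 * x ^ s \<le> k * x ^ s" using assms by (intro mult_right_mono) auto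
    then show ?thesis using assms(5) by (simp add: d_def)
  qed
  finally have "1 - d / 2 \<le> real s * d" by simp
  then have "(1 - d / 2) ^ s \<le> (real s * d) ^ s" using d by (intro power_mono) auto
  moreover have "1 - real s * (d / 2) \<le> (1 - d / 2) ^ s"
    using Bernoulli_inequality[of "- (d / 2)" s] d by simp
  \<comment> \<open>From \<open>2 * d \<le> s * d < 1\<close> follow \<open>d < 1/2\<close> and
    \<open>1 - s * d / 2 > 1/2\<close>, so the second Bernoulli bound suffices.\<close>
  ultimately have "d \<le> (real s * d) ^ s" using sd \<open>2 * d \<le> real s * d\<close> by simp
  then show ?thesis by (simp add: d_def)
qed

section \<open>Construction of the complement and choice of parameters\<close>

lemma minimal_complementI:
  fixes C :: "'a::ab_group_add set"
  assumes "\<And>g. \<not> translate g (uminus ` C) \<subseteq> (\<Union>c\<in>C. translate (f c) (uminus ` (C - {c})))"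
  shows "minimal_complement C"
proof -
  define W where "W = - (\<Union>c\<in>C. translate (f c) (uminus ` (C - {c})))"
  \<comment> \<open>A sum \<open>x + c = g\<close> with \<open>c\<close> in \<open>C\<close> means
    that \<open>x\<close> lies in the translate by \<open>g\<close> of the reflected set; so
    \<open>g\<close> is reached as soon as this translate meets \<open>W\<close>.\<close>
  have "g \<in> W + C" for g
  proof -
    from assms[of g] obtain x where "x \<in> W" "x \<in> translate g (uminus ` C)"
      unfolding W_def by blast
    then obtain c where "x \<in> W" "c \<in> C" "x - g = - c" by (auto simp: mem_translate)
    moreover from this have "g = x + c" by (simp add: algebra_simps)
    ultimately show ?thesis by (simp add: set_plus_intro)
  qed
  moreover have "W + C' \<noteq> UNIV" if "C' \<subset> C" for C'
  proof -
    from that obtain c where c: "c \<in> C" "c \<notin> C'" by auto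
    have "f c \<notin> W + C'"
    proof
      assume "f c \<in> W + C'"
      then obtain w c' where w: "w \<in> W" "c' \<in> C'" "f c = w + c'" by (auto elim: set_plus_elim)
      then have "w - f c = - c'" "c' \<in> C - {c}" using that c by auto
      then have "w \<in> translate (f c) (uminus ` (C - {c}))" by (auto simp: mem_translate)
      with w(1) c(1) show False by (auto simp: W_def)
    qed
    then show ?thesis by auto
  qed
  ultimately show ?thesis unfolding minimal_complement_def by blast
qed

theorem theorem3p1:
  fixes C :: "'a::{ab_group_add, finite} set"
    and n k :: nat
  assumes "CARD('a) = n"
    and "C \<noteq> {}"
    and "card C = k"
    and "\<exists>s::nat. s > 0 \<and>
           real s ^ 2 * real k ^ 3 / real n
           + exp 1 ^ s * real k ^ (3 * s) / real n ^ (s - 1)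
           + real k * (real s ^ 2 * real k ^ 3 / real n) ^ s < 1"
  shows "minimal_complement C"
proof -
  obtain s where "s > 0" and s: "real s ^ 2 * real k ^ 3 / real n
           + exp 1 ^ s * real k ^ (3 * s) / real n ^ (s - 1)
           + real k * (real s ^ 2 * real k ^ 3 / real n) ^ s < 1"
    using assms(4) by blast
  define D where "D = uminus ` C"
  define A where "A c = uminus ` (C - {c})" for c
  have D: "card D = k" "D \<noteq> {}" using assms by (auto simp: D_def card_image)
  have A: "A c \<subset> D" if "c \<in> C" for c using that by (force simp: A_def D_def)
  have "n > 0" "k > 0" using assms by (auto simp: card_gt_0_iff)
  \<comment> \<open>\<open>x\<close> bounds the proportion of positions excluded by conflicts,
    \<open>\<delta>\<close> is the proportion left, and \<open>T\<close> is the term to be compared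
    with the Chernoff bound.\<close>
  define x \<delta> T where "x = real s ^ 2 * real k ^ 3 / real n" and "\<delta> = 1 - x"
    and "T = exp 1 ^ s * real k ^ (3 * s) / real n ^ (s - 1)"
  have "x \<ge> 0" "T \<ge> 0" by (auto simp: x_def T_def)
  have sum_lt: "x + T + real k * x ^ s < 1" using s by (simp add: x_def T_def)
  have "real k * x ^ s \<ge> 0" using \<open>x \<ge> 0\<close> by simp
  with sum_lt \<open>T \<ge> 0\<close> \<open>x \<ge> 0\<close> have "T < \<delta>" "\<delta> > 0" "x < 1" "T < 1" "real k * x ^ s \<le> 1 - x"
    unfolding \<delta>_def by linarith+
  show ?thesis
  proof (cases "k = 1")
    case True
    then obtain c where "C = {c}" using assms(3) card_1_singletonE by blast
    then show ?thesis
      by (intro minimal_complementI[of C "\<lambda>_. 0"]) (auto simp: translate_def)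
  next
    case False
    with \<open>k > 0\<close> have "k \<ge> 2" by simp
    \<comment> \<open>For \<open>s = 1\<close> the denominator of \<open>T\<close> is an empty
      power, so \<open>T\<close> is at least 1. The numerical inequality requires
      \<open>s \<ge> 2\<close>.\<close>
    have "s \<noteq> 1"
    proof
      assume "s = 1"
      then have "T = exp 1 * real k ^ 3" by (simp add: T_def)
      moreover have "1 * 1 \<le> exp 1 * real k ^ 3"
        using \<open>k \<ge> 2\<close> by (intro mult_mono one_le_power) auto
      ultimately show False using \<open>T < 1\<close> by simp
    qed
    with \<open>s > 0\<close> have "s \<ge> 2" by simp
    \<comment> \<open>Chosen so that the growth factor of the potential is \<open>1 + s / k\<close>,
      whose \<open>k\<close>-th power is at most \<open>exp 1 ^ s\<close>.\<close>
    define z where "z = 1 + real s * \<delta> * real n / real k ^ 3"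
    have "z > 1" using \<open>s > 0\<close> \<open>\<delta> > 0\<close> \<open>n > 0\<close> \<open>k > 0\<close> by (simp add: z_def)
    define bad where "bad c e c' h \<longleftrightarrow>
        conflict (s - 1) D (translate e (A c)) (translate h (A c')) \<or>
        conflict (s - 1) D (translate h (A c')) (translate e (A c))" for c e c' h
    define meets where "meets g c h \<longleftrightarrow> translate h (A c) \<inter> translate g D \<noteq> {}" for g c h
    have "\<exists>f. (\<forall>c\<in>C. \<forall>c'\<in>C. c \<noteq> c' \<longrightarrow> \<not> bad c (f c) c' (f c')) \<and>
       (\<Sum>g\<in>UNIV. z ^ card {c\<in>C. meets g c (f c)})
         \<le> CARD('a) * (1 + (z - 1) * real (k ^ 2) / (\<delta> * CARD('a))) ^ card C"
    proof (rule greedy_choice)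
      show "card {h. bad c e c' h} \<le> s ^ 2 * k ^ 2" if "c \<in> C" "c' \<in> C" for c e c'
        using card_conflicts[OF A A, OF that, of "s - 1" e] \<open>s > 0\<close> D by (simp add: bad_def)
      show "card {h. meets g c h} \<le> k ^ 2" if "c \<in> C" for g c
      proof -
        have "card {h. meets g c h} \<le> card (A c) * card (translate g D)"
          unfolding meets_def by (rule card_meeting_translates)
        also have "\<dots> \<le> k * k" using psubset_card_mono[OF _ A[OF that]] D by (intro mult_mono) auto
        finally show ?thesis by (simp add: power2_eq_square)
      qed
      show "real (card C * (s ^ 2 * k ^ 2)) \<le> (1 - \<delta>) * real CARD('a)"
        using assms(1,3) \<open>n > 0\<close> by (simp add: \<delta>_def x_def power2_eq_square power3_eq_cube)
    qed (use \<open>z > 1\<close> \<open>\<delta> > 0\<close> in \<open>auto simp: bad_def\<close>)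
    then obtain f where
      f: "\<And>c c'. c \<in> C \<Longrightarrow> c' \<in> C \<Longrightarrow> c \<noteq> c' \<Longrightarrow> \<not> bad c (f c) c' (f c')"
      and pot: "(\<Sum>g\<in>UNIV. z ^ card {c\<in>C. meets g c (f c)})
         \<le> n * (1 + (z - 1) * real (k ^ 2) / (\<delta> * n)) ^ k"
      using assms(1,3) by blast
    have "(1 + (z - 1) * real (k ^ 2) / (\<delta> * n)) = 1 + real s / real k"
      using \<open>\<delta> > 0\<close> \<open>n > 0\<close> \<open>k > 0\<close>
      by (simp add: z_def field_simps power2_eq_square power3_eq_cube)
    also have "\<dots> \<le> exp (real s / real k)" by (rule exp_ge_add_one_self)
    finally have "(1 + (z - 1) * real (k ^ 2) / (\<delta> * n)) ^ k \<le> exp (real s / real k) ^ k"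
      using \<open>z > 1\<close> \<open>\<delta> > 0\<close> by (intro power_mono) auto
    also have "\<dots> = exp 1 ^ s"
      using \<open>k > 0\<close> by (simp flip: exp_of_nat_mult)
    finally have chernoff: "n * (1 + (z - 1) * real (k ^ 2) / (\<delta> * n)) ^ k \<le> n * exp 1 ^ s"
      by (intro mult_left_mono) auto
    have "n * exp 1 ^ s = T * (real n / real k ^ 3) ^ s"
    proof -
      have "real n ^ s = real n * real n ^ (s - 1)"
        using \<open>s > 0\<close> by (simp flip: power_Suc)
      then show ?thesis using \<open>n > 0\<close> \<open>k > 0\<close>
        by (simp add: T_def power_divide power_mult)
    qed
    \<comment> \<open>Here \<open>T < \<delta> \<le> (s * \<delta>) ^ s\<close>. The second
      inequality is where the third summand of the hypothesis enters, as
      \<open>k * x ^ s \<le> 1 - x\<close>.\<close>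
    also have "\<dots> \<le> (real s * \<delta>) ^ s * (real n / real k ^ 3) ^ s"
      using le_power_mult_one_minus[of x s "real k"] \<open>x \<ge> 0\<close> \<open>x < 1\<close> \<open>s \<ge> 2\<close> \<open>k \<ge> 2\<close>
        \<open>real k * x ^ s \<le> 1 - x\<close> \<open>T < \<delta>\<close>
      by (intro mult_right_mono) (auto simp: \<delta>_def)
    also have "\<dots> = (z - 1) ^ s" by (simp add: z_def flip: power_mult_distrib)
    also have "\<dots> < z ^ s" using \<open>z > 1\<close> \<open>s > 0\<close> by (intro power_strict_mono) auto
    finally have "n * exp 1 ^ s < z ^ s" .
    with pot chernoff have few: "(\<Sum>g\<in>UNIV. z ^ card {c\<in>C. meets g c (f c)}) < z ^ s" by linarith
    show ?thesis
    proof (rule minimal_complementI[of C f], unfold D_def[symmetric] A_def[symmetric], rule notI)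
      fix g assume cover: "translate g D \<subseteq> (\<Union>c\<in>C. translate (f c) (A c))"
      define M where "M = {c\<in>C. meets g c (f c)}"
      \<comment> \<open>A single term of the potential with exponent at least \<open>s\<close> would
        already exceed the bound on the whole sum. Sets outside \<open>M\<close> miss the translate,
        so those in \<open>M\<close> still cover it.\<close>
      have "z ^ card M \<le> (\<Sum>g\<in>UNIV. z ^ card {c\<in>C. meets g c (f c)})"
        unfolding M_def using \<open>z > 1\<close> by (intro member_le_sum) auto
      with few have "z ^ card M < z ^ s" by linarith
      then have "card M \<le> s - 1" using \<open>z > 1\<close> by simp
      moreover have "translate g D \<subseteq> (\<Union>c\<in>M. translate (f c) (A c))"
        using cover unfolding M_def meets_def by blast
      moreover have "card (translate (f c) (A c)) < card D" if "c \<in> M" for c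
        using that A by (simp add: M_def psubset_card_mono)
      ultimately obtain c c' where "c \<in> M" "c' \<in> M" "c \<noteq> c'"
        "conflict (s - 1) D (translate (f c) (A c)) (translate (f c') (A c'))"
        using cover_imp_conflict[of M D g "\<lambda>c. translate (f c) (A c)" "s - 1"] D(2) finite by metis
      with f[of c c'] show False by (simp add: M_def bad_def)
    qed
  qed
qed

end
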